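(* Assume that, for every grid index $i\in\mathcal I$, the polynomial $R_i(x)$ satisfies $$\frac1{\Delta x}\int_{x_{i-\frac12}}^{x_{i+\frac12}}R_i(x)\,dx=\bar u_i .$$ Then, for periodic functions $\bar u(x)$ with period $L=N\Delta x$, $N\in\mathbb N$, $$\sum_{i=1}^N Q_{i+\theta}=\sum_{i=1}^N\bar u_i$$ for any $\theta\in[0,1)$.
   Context: Uniform grid: $\Delta x>0$, $x_i=i\Delta x$, $x_{i\pm\frac12}=x_i\pm\Delta x/2$, with $\mathcal I$ the set of grid indices. For a smooth function $u:\mathbb R\to\mathbb R$, its sliding average is $\bar u(x)=\frac1{\Delta x}\int_{x-\Delta x/2}^{x+\Delta x/2}u(y)\,dy$, and $\bar u_i=\bar u(x_i)$ are the given cell averages. From the cell averages one has a piecewise polynomial reconstruction $R(x)=\sum_i R_i(x)\chi_i(x)$ of $u$, where $\chi_i$ is the characteristic function of the cell $[x_{i-\frac12},x_{i+\frac12}]$ and $R_i$ is a polynomial of degree $k$. For $\theta\in[0,1)$, with $x_{i\pm\frac12+\theta}=x_{i\pm\frac12}+\theta\Delta x$, the approximation of $\bar u(x_i+\theta\Delta x)$ is the sliding average of $R$: $$Q_{i+\theta}=\frac1{\Delta x}\int_{x_{i-\frac12+\theta}}^{x_{i+\frac12+\theta}}R(x)\,dx=\frac1{\Delta x}\int_{x_{i-\frac12+\theta}}^{x_{i+\frac12}}R_i(x)\,dx+\frac1{\Delta x}\int_{x_{i+\frac12}}^{x_{i+\frac12+\theta}}R_{i+1}(x)\,dx .$$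
   Formalization: The formal statement adds that the reconstruction inherits the period: if the cell averages are N-periodic then R_{i+N}(x+NΔx)=R_i(x); without this link between R_{N+1} and R_1 the claim fails. *)

theory Defs
  imports "HOL-Analysis.Analysis" "HOL-Computational_Algebra.Polynomial"
begin

definition smooth_fun :: "(real \<Rightarrow> real) \<Rightarrow> bool" where
  "smooth_fun u \<longleftrightarrow> (\<forall>n x. (deriv ^^ n) u differentiable (at x))"

definition sliding_average :: "real \<Rightarrow> (real \<Rightarrow> real) \<Rightarrow> real \<Rightarrow> real" where
  "sliding_average dx u x = (1 / dx) * integral {x - dx / 2 .. x + dx / 2} u"

definition grid_point :: "real \<Rightarrow> int \<Rightarrow> real" where
  "grid_point dx i = of_int i * dx"

definition cell :: "real \<Rightarrow> int \<Rightarrow> real set" where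
  "cell dx i = {grid_point dx i - dx / 2 .. grid_point dx i + dx / 2}"

definition cell_average :: "real \<Rightarrow> (real \<Rightarrow> real) \<Rightarrow> int \<Rightarrow> real" where
  "cell_average dx u i = sliding_average dx u (grid_point dx i)"

(* The sum has at most two nonzero terms at every x. The cells are closed, so at an
   interface both neighbouring polynomials contribute; this affects only a null set. *)
definition piecewise_poly :: "real \<Rightarrow> (int \<Rightarrow> real poly) \<Rightarrow> real \<Rightarrow> real" where
  "piecewise_poly dx R x = (\<Sum>\<^sub>\<infinity>i. poly (R i) x * indicat_real (cell dx i) x)"

definition Q :: "real \<Rightarrow> (int \<Rightarrow> real poly) \<Rightarrow> int \<Rightarrow> real \<Rightarrow> real" where
  "Q dx R i \<theta> = sliding_average dx (piecewise_poly dx R) (grid_point dx i + \<theta> * dx)"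

(* On a uniform grid the polynomials are computed from the cell averages by the same rule
   in every cell, so N-periodic averages a give an N-periodic reconstruction. Only this
   consequence of being reconstructed from the averages is recorded here; without it the
   polynomials R 1 and R (N + 1) would be unrelated. *)
definition inherits_period :: "real \<Rightarrow> nat \<Rightarrow> (int \<Rightarrow> real) \<Rightarrow> (int \<Rightarrow> real poly) \<Rightarrow> bool" where
  "inherits_period dx N a R \<longleftrightarrow>
     ((\<forall>i. a (i + int N) = a i) \<longrightarrow>
      (\<forall>i x. poly (R (i + int N)) (x + real N * dx) = poly (R i) x))"

end

theory Submission
  imports Defs
begin

text \<open>
  Let \<open>H i\<close> be the integral of \<open>R i\<close> over the leftmost part, of length \<open>\<theta> dx\<close>, of cell \<open>i\<close>.
  Shifting the averaging window by \<open>\<theta> dx\<close> drops \<open>H i\<close> and picks up \<open>H (i + 1)\<close>, so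
  \<open>dx * Q dx R i \<theta>\<close> is \<open>dx\<close> times the cell average plus \<open>H (i + 1) - H i\<close>. The corrections
  telescope to \<open>H (N + 1) - H 1\<close>, which vanishes by periodicity.
\<close>

lemma grid_point_add: "grid_point dx (i + j) = grid_point dx i + of_int j * dx"
  by (simp add: grid_point_def algebra_simps)

text \<open>The distances from \<open>x\<close> to the two centres add up to less than
  \<open>dx\<close>, because one of the two bounds is strict, whereas distinct centres are at least
  \<open>dx\<close> apart.\<close>

lemma interior_cell_unique:
  assumes "dx > 0"
    and "x \<in> {grid_point dx i - dx / 2 <..< grid_point dx i + dx / 2}"
    and "x \<in> cell dx j"
  shows "j = i"
proof -
  have "\<bar>real_of_int i * dx - of_int j * dx\<bar> < 1 * dx"
    using assms(2,3) by (auto simp: cell_def grid_point_def abs_less_iff)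
  then have "\<bar>real_of_int i - of_int j\<bar> * dx < 1 * dx"
    using assms(1) by (simp add: left_diff_distrib[symmetric] abs_mult)
  then have "\<bar>real_of_int i - of_int j\<bar> < 1"
    using assms(1) by (simp only: mult_less_cancel_right_pos)
  then show ?thesis by linarith
qed

text \<open>Away from the interfaces only one indicator is nonzero, so the infinite sum reduces to a
  single term and no question of summability arises.\<close>

lemma piecewise_poly_interior:
  assumes "dx > 0"
    and "x \<in> {grid_point dx i - dx / 2 <..< grid_point dx i + dx / 2}"
  shows "piecewise_poly dx R x = poly (R i) x"
proof -
  have "piecewise_poly dx R x = (\<Sum>\<^sub>\<infinity>j\<in>{i}. poly (R j) x * indicat_real (cell dx j) x)"
    unfolding piecewise_poly_def
    by (rule infsum_cong_neutral) (use interior_cell_unique[OF assms] in \<open>auto simp: indicator_def\<close>)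
  also have "\<dots> = poly (R i) x"
    using assms(2) by (simp add: cell_def)
  finally show ?thesis .
qed

lemma poly_integrable_on: "poly p integrable_on {a..b::real}"
  by (intro integrable_continuous_interval continuous_intros)

text \<open>At an interface two cell polynomials are added, so \<open>piecewise_poly\<close> may
  differ from \<open>R i\<close> at the two ends of the cell; finitely many values do not affect the
  integral.\<close>

lemma has_integral_piecewise_poly:
  assumes "dx > 0" and "{a..b} \<subseteq> cell dx i"
  shows "(piecewise_poly dx R has_integral integral {a..b} (poly (R i))) {a..b}"
proof (rule has_integral_spike_finite)
  show "finite {grid_point dx i - dx / 2, grid_point dx i + dx / 2}" by simp
  show "(poly (R i) has_integral integral {a..b} (poly (R i))) {a..b}"
    by (rule integrable_integral[OF poly_integrable_on])
  fix x assume "x \<in> {a..b} - {grid_point dx i - dx / 2, grid_point dx i + dx / 2}"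
  then have "x \<in> {grid_point dx i - dx / 2 <..< grid_point dx i + dx / 2}"
    using assms(2) unfolding cell_def by fastforce
  then show "piecewise_poly dx R x = poly (R i) x"
    by (rule piecewise_poly_interior[OF assms(1)])
qed

definition left_part_integral :: "real \<Rightarrow> (int \<Rightarrow> real poly) \<Rightarrow> real \<Rightarrow> int \<Rightarrow> real" where
  "left_part_integral dx R \<theta> i =
     integral {grid_point dx i - dx / 2 .. grid_point dx i - dx / 2 + \<theta> * dx} (poly (R i))"

lemma Q_eq_cell_integral:
  assumes dx: "dx > 0" and \<theta>: "0 \<le> \<theta>" "\<theta> \<le> 1"
  shows "Q dx R i \<theta> = (1 / dx) * (integral (cell dx i) (poly (R i))
           + left_part_integral dx R \<theta> (i + 1) - left_part_integral dx R \<theta> i)"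
proof -
  define l where "l = grid_point dx i - dx / 2"
  have l': "grid_point dx (i + 1) - dx / 2 = l + dx"
    by (simp add: l_def grid_point_add)
  have ci: "cell dx i = {l..l + dx}" and ci': "cell dx (i + 1) = {l + dx..l + dx + dx}"
    by (simp_all add: cell_def l_def grid_point_add)
  have ord: "0 \<le> \<theta> * dx" "\<theta> * dx \<le> dx"
    using dx \<theta> by (simp_all add: mult_le_cancel_right1)
  \<comment> \<open>The window is cut at the interface \<open>l + dx\<close>. Since \<theta> lies
    between 0 and 1, the left piece stays in cell \<open>i\<close> and the right piece in cell
    \<open>i + 1\<close>.\<close>
  have "(piecewise_poly dx R has_integral
          integral {l + \<theta> * dx..l + dx} (poly (R i))
          + integral {l + dx..l + dx + \<theta> * dx} (poly (R (i + 1)))) {l + \<theta> * dx..l + dx + \<theta> * dx}"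
    by (rule has_integral_combine[where c = "l + dx"])
      (use ord in \<open>auto intro!: has_integral_piecewise_poly[OF dx] simp: ci ci'\<close>)
  \<comment> \<open>Adding back the dropped left part restores the whole cell, the only domain on
    which the integral of \<open>R i\<close> is prescribed by the cell averages.\<close>
  moreover have split: "integral {l..l + \<theta> * dx} (poly (R i)) + integral {l + \<theta> * dx..l + dx} (poly (R i))
      = integral (cell dx i) (poly (R i))"
    unfolding ci by (rule Henstock_Kurzweil_Integration.integral_combine)
      (use ord in \<open>auto intro: poly_integrable_on\<close>)
  moreover have window: "grid_point dx i + \<theta> * dx - dx / 2 = l + \<theta> * dx"
    "grid_point dx i + \<theta> * dx + dx / 2 = l + dx + \<theta> * dx"
    by (simp_all add: l_def)
  ultimately show ?thesis
    unfolding Q_def sliding_average_def left_part_integral_def l' l_def[symmetric] window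
    by (simp add: integral_unique split[symmetric])
qed

text \<open>The polynomial N cells further on is a translate of \<open>R i\<close>, in general not
  \<open>R i\<close> itself; substituting x + N dx for x undoes the translation.\<close>

lemma left_part_integral_shift:
  assumes "\<And>x. poly (R (i + int N)) (x + real N * dx) = poly (R i) x"
  shows "left_part_integral dx R \<theta> (i + int N) = left_part_integral dx R \<theta> i"
proof -
  let ?a = "grid_point dx i - dx / 2" and ?b = "grid_point dx i - dx / 2 + \<theta> * dx"
  have "left_part_integral dx R \<theta> (i + int N)
      = integral {?a + real N * dx..?b + real N * dx} (poly (R (i + int N)))"
    by (simp add: left_part_integral_def grid_point_add algebra_simps)
  also have "\<dots> = integral {?a..?b} (\<lambda>x. poly (R (i + int N)) (x + real N * dx))"
    using integral_shift_Icc_real[of ?a ?b "poly (R (i + int N))" "real N * dx"]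
    by (simp add: o_def add.commute[of "real N * dx"])
  finally show ?thesis
    by (simp add: assms left_part_integral_def)
qed

lemma sum_int_telescope:
  fixes f :: "int \<Rightarrow> 'a::ab_group_add"
  shows "(\<Sum>i = 1..int n. f (i + 1) - f i) = f (int n + 1) - f 1"
proof (induction n)
  case (Suc n)
  have "{1..int (Suc n)} = insert (int n + 1) {1..int n}" by auto
  with Suc show ?case by (simp add: algebra_simps)
qed simp

theorem proposition2p3:
  fixes dx L \<theta> :: real and N k :: nat
    and u :: "real \<Rightarrow> real" and R :: "int \<Rightarrow> real poly"
  assumes "dx > 0"
    and "smooth_fun u"
    and "\<And>i. degree (R i) \<le> k"
    and "inherits_period dx N (cell_average dx u) R"
    and "\<And>i. (1 / dx) * integral (cell dx i) (poly (R i)) = cell_average dx u i"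
    and "L = real N * dx"
    and "\<And>x. sliding_average dx u (x + L) = sliding_average dx u x"
    and "0 \<le> \<theta>" and "\<theta> < 1"
  shows "(\<Sum>i = 1..int N. Q dx R i \<theta>) = (\<Sum>i = 1..int N. cell_average dx u i)"
proof -
  let ?H = "left_part_integral dx R \<theta>"
  \<comment> \<open>The period is exactly N grid steps, so the shift maps grid points to grid
    points; this discharges the premise inside \<open>inherits_period\<close>.\<close>
  have "cell_average dx u (i + int N) = cell_average dx u i" for i
    using assms(6,7) by (simp add: cell_average_def grid_point_add)
  then have "poly (R (i + int N)) (x + real N * dx) = poly (R i) x" for i x
    using assms(4) by (simp add: inherits_period_def)
  then have "?H (1 + int N) = ?H 1"
    by (rule left_part_integral_shift)
  then have "(\<Sum>i = 1..int N. ?H (i + 1) - ?H i) = 0"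
    by (simp add: sum_int_telescope add.commute)
  \<comment> \<open>Conservation enters here: it turns the full-cell integral of \<open>R i\<close>
    into the cell average.\<close>
  moreover have "Q dx R i \<theta> = cell_average dx u i + (1 / dx) * (?H (i + 1) - ?H i)" for i
    using assms(1,8,9) by (simp add: Q_eq_cell_integral assms(5)[symmetric] add_divide_distrib diff_divide_distrib)
  ultimately show ?thesis
    by (simp add: sum.distrib sum_distrib_left[symmetric] sum_divide_distrib[symmetric])
qed

end
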